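(* Let $(\boldsymbol g_t)_{t\ge 1}\subset\mathbb R^d$ be any sequence with $\|\boldsymbol g_1\|>0$, and let $(h_t)_{t\ge1}$ be hints such that $(h_t)$ is non-decreasing, $h_t\ge \max_{s\le t}\|\boldsymbol g_s\|$ for all $t\ge 1$, and the hints are multiplied by $c$ whenever the sequence $(\boldsymbol g_s)$ is multiplied by a factor $c>0$. Let $(\widehat{\boldsymbol w}_t)$ be the outputs of FreeGrad (defined in the context). Then for all $\boldsymbol w\in\mathbb R^d$ and $T\ge1$, $$\sum_{t=1}^T\langle\boldsymbol g_t,\widehat{\boldsymbol w}_t-\boldsymbol w\rangle\le\left[2\|\boldsymbol w\|\sqrt{V_T\ln_+\left(\frac{2\|\boldsymbol w\|V_T}{h_1^2}\right)}\right]\vee\left[4h_T\|\boldsymbol w\|\ln\left(\frac{4h_T\|\boldsymbol w\|\sqrt{V_T}}{h_1^2}\right)\right]+h_1 .$$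
   Context: $\|\cdot\|$ is the Euclidean norm, $a\vee b=\max\{a,b\}$, $\ln_+(\cdot):=0\vee\ln(\cdot)$, $\ln_+ 0=0$ and $0\ln 0=0$ (relevant only for $\boldsymbol w=\boldsymbol 0$). In each round $t\ge1$ the learner sees a hint $h_t$, outputs $\widehat{\boldsymbol w}_t\in\mathbb R^d$, and then $\boldsymbol g_t\in\mathbb R^d$ is revealed. Let $\mathbf G_t:=\sum_{s=1}^t\boldsymbol g_s$ and $V_t:=h_1^2+\sum_{s=1}^t\|\boldsymbol g_s\|^2$ for $t\ge0$. FreeGrad outputs in round $t\ge 1$: $$\widehat{\boldsymbol w}_t:=-\mathbf G_{t-1}\cdot\frac{(2V_{t-1}+h_t\|\mathbf G_{t-1}\|)\,h_1^2}{2(V_{t-1}+h_t\|\mathbf G_{t-1}\|)^2\sqrt{V_{t-1}}}\cdot\exp\left(\frac{\|\mathbf G_{t-1}\|^2}{2V_{t-1}+2h_t\|\mathbf G_{t-1}\|}\right).$$ *)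

theory Defs
  imports "HOL-Analysis.Analysis"
begin

text \<open>Rounds are numbered from 1: all sequences are functions on \<^typ>\<open>nat\<close> whose value
  at 0 is never used.\<close>

text \<open>Since \<^term>\<open>ln (0::real) = 0\<close> in HOL, this gives \<open>ln_plus 0 = 0\<close>.\<close>

definition ln_plus :: "real \<Rightarrow> real" where
  "ln_plus x = max 0 (ln x)"

definition grad_sum :: "(nat \<Rightarrow> real ^ 'd) \<Rightarrow> nat \<Rightarrow> real ^ 'd" where
  "grad_sum g t = (\<Sum>s = 1..t. g s)"

definition grad_var :: "(nat \<Rightarrow> real) \<Rightarrow> (nat \<Rightarrow> real ^ 'd) \<Rightarrow> nat \<Rightarrow> real" where
  "grad_var h g t = (h 1)\<^sup>2 + (\<Sum>s = 1..t. (norm (g s))\<^sup>2)"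

definition freegrad :: "(nat \<Rightarrow> real) \<Rightarrow> (nat \<Rightarrow> real ^ 'd) \<Rightarrow> nat \<Rightarrow> real ^ 'd" where
  "freegrad h g t =
    (let G = grad_sum g (t - 1); V = grad_var h g (t - 1) in
      (((2 * V + h t * norm G) * (h 1)\<^sup>2) / (2 * (V + h t * norm G)\<^sup>2 * sqrt V)
        * exp ((norm G)\<^sup>2 / (2 * V + 2 * h t * norm G))) *\<^sub>R (- G))"

text \<open>The hints may depend on the gradients, so a hinting scheme maps gradient sequences to
  hint sequences. Scale equivariance at \<open>g\<close>: multiplying \<open>g\<close> by \<open>c > 0\<close> multiplies
  the hints by \<open>c\<close>.\<close>

definition scale_equivariant_at ::
    "((nat \<Rightarrow> real ^ 'd) \<Rightarrow> nat \<Rightarrow> real) \<Rightarrow> (nat \<Rightarrow> real ^ 'd) \<Rightarrow> bool" where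
  "scale_equivariant_at H g \<longleftrightarrow>
    (\<forall>c>0. \<forall>t\<ge>1. H (\<lambda>s. c *\<^sub>R g s) t = c * H g t)"

end

theory Submission
  imports Defs
begin

text \<open>FreeGrad plays the negative gradient of the potential
  \<open>h\<^sub>1\<^sup>2 / sqrt V * exp (\<bar>G\<bar>\<^sup>2 / (2 V + 2 h \<bar>G\<bar>))\<close>. In each round the
  potential grows by at most its linearisation, so the cumulative loss telescopes to at most
  \<open>h\<^sub>1\<close> minus the final potential. The regret against \<open>w\<close> is then bounded by the
  convex conjugate of the potential at \<open>\<bar>w\<bar>\<close>; its two regimes
  \<open>h \<bar>G\<bar> \<le> V\<close> and \<open>h \<bar>G\<bar> > V\<close> give the two terms of the maximum.

  For the one-round inequality, only the length of \<open>G + g\<close> depends on the component of \<open>g\<close>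
  orthogonal to \<open>G\<close>, and enlarging that component helps; what remains is a scalar inequality,
  which becomes polynomial once the logarithms are replaced by rational lower bounds.\<close>

subsection \<open>Rational lower bounds for the logarithm\<close>

text \<open>Both sides agree to second order at 0, and their difference has a manifestly nonnegative
  rational derivative.\<close>

lemma ln_1_plus_ge_nonneg:
  fixes u :: real
  assumes "0 \<le> u"
  shows "2 * u / (2 + u) \<le> ln (1 + u)"
proof -
  define f where "f = (\<lambda>u::real. ln (1 + u) - 2 * u / (2 + u))"
  have "f 0 \<le> f u"
  proof (rule DERIV_nonneg_imp_nondecreasing[OF assms])
    fix t :: real assume t: "0 \<le> t" "t \<le> u"
    let ?D = "1 / (1 + t) - (2 * (2 + t) - 2 * t) / ((2 + t) * (2 + t))"
    have "(f has_real_derivative ?D) (at t)"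
      unfolding f_def using t by (auto intro!: derivative_eq_intros)
    moreover have "?D = t^2 / ((1 + t) * (2 + t)^2)"
      using t by (simp add: divide_simps) (simp add: algebra_simps power2_eq_square)
    ultimately show "\<exists>y. (f has_real_derivative y) (at t) \<and> 0 \<le> y"
      using t by (intro exI[of _ ?D]) auto
  qed
  then show ?thesis by (simp add: f_def)
qed

text \<open>For \<open>-1 < u < 0\<close> the fraction \<open>2 * u / (2 + u)\<close> lies above
  \<open>ln (1 + u)\<close>, so decreasing factors need another bound. This one again agrees with
  the logarithm to second order at 1.\<close>

lemma ln_ge_le_1:
  fixes r :: real
  assumes "0 < r" "r \<le> 1"
  shows "r / 2 - 1 / (2 * r) \<le> ln r"
proof -
  define f where "f = (\<lambda>r::real. ln r - r / 2 + 1 / (2 * r))"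
  have "f 1 \<le> f r"
  proof (rule DERIV_nonpos_imp_nonincreasing[OF assms(2)])
    fix t :: real assume t: "r \<le> t" "t \<le> 1"
    then have "0 < t" using assms by simp
    let ?D = "1 / t - 1 / 2 - 2 / ((2 * t) * (2 * t))"
    have "(f has_real_derivative ?D) (at t)"
      unfolding f_def using \<open>0 < t\<close> by (auto intro!: derivative_eq_intros)
    moreover have "?D = - ((1 - t)^2 / (2 * t^2))"
      using \<open>0 < t\<close> by (simp add: divide_simps) (simp add: algebra_simps power2_eq_square)
    ultimately show "\<exists>y. (f has_real_derivative y) (at t) \<and> y \<le> 0"
      by (intro exI[of _ ?D]) auto
  qed
  then show ?thesis by (simp add: f_def)
qed

lemma half_ln_1_plus_ge:
  fixes V b :: real
  assumes "0 < V"
  shows "b^2 / (2 * V + b^2) \<le> ln (1 + b^2 / V) / 2"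
proof -
  have "2 * V + b^2 = V * (2 + b^2 / V)" using assms by (simp add: field_simps)
  then have "b^2 / (2 * V + b^2) = (2 * (b^2 / V) / (2 + b^2 / V)) / 2" by simp
  also have "\<dots> \<le> ln (1 + b^2 / V) / 2"
    using assms by (intro divide_right_mono ln_1_plus_ge_nonneg) auto
  finally show ?thesis .
qed

subsection \<open>The scalar one-round inequality\<close>

text \<open>Logarithmic form of \<open>potential_step\<close> when g points along G:
  \<open>x\<close> is the length of G, \<open>b\<close> that of g, and
  \<open>x * (V + W) / (2 * W^2)\<close> is the derivative in \<open>x\<close> of the exponent
  \<open>x^2 / (2 * (V + h * x))\<close>.\<close>

lemma scalar_step_pos:
  fixes V b x h :: real
  assumes V: "0 < V" and b: "0 \<le> b" "b \<le> h" and x: "0 \<le> x"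
  defines "W \<equiv> V + h * x"
  shows "(x + b)^2 / (2 * (V + b^2 + h * (x + b))) \<le>
    x^2 / (2 * W) + ln (1 + b * (x * (V + W) / (2 * W^2))) + ln (1 + b^2 / V) / 2"
proof -
  define N where "N = x * (V + W)"
  define D where "D = 2 * (V + b^2 + h * (x + b))"
  define P where "P = 4 * W^2 + b * N"
  define B where "B = 2 * V + b^2"
  have W: "0 < W" using V b x by (simp add: W_def add_pos_nonneg)
  have N: "0 \<le> N" using V x W by (simp add: N_def)
  have P: "0 < P" using W b N by (simp add: P_def add_pos_nonneg)
  have D: "0 < D" and B: "0 < B" using V b x by (simp_all add: D_def B_def add_pos_nonneg)
  \<comment> \<open>The slack turns the constraint \<open>b \<le> h\<close> into a sign condition on
    a variable.\<close>
  define e where "e = h - b"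
  have e: "h = b + e" "0 \<le> e" using b by (simp_all add: e_def)
  \<comment> \<open>Expanded in \<open>V, b, x, e\<close>, this polynomial has only nonnegative coefficients.\<close>
  have "0 \<le> x^2 * P * B * D + 2 * W * (2 * b * N) * B * D + 2 * W * P * b^2 * D
      - 2 * W * P * B * (x + b)^2"
    using V b x e(2) unfolding P_def B_def D_def N_def W_def e(1)
    by (simp add: algebra_simps power2_eq_square power3_eq_cube)
  then have "0 \<le> (x^2 * P * B * D + 2 * W * (2 * b * N) * B * D + 2 * W * P * b^2 * D
      - 2 * W * P * B * (x + b)^2) / (2 * W * P * B * D)"
    using W P B D by simp
  also have "\<dots> = x^2 / (2 * W) + 2 * b * N / P + b^2 / B - (x + b)^2 / D"
    using W P B D by (simp add: add_divide_distrib diff_divide_distrib)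
  finally have "(x + b)^2 / D \<le> x^2 / (2 * W) + 2 * b * N / P + b^2 / B" by simp
  moreover have "2 * b * N / P \<le> ln (1 + b * (N / (2 * W^2)))"
  proof -
    have "2 * b * N / P = 2 * (b * (N / (2 * W^2))) / (2 + b * (N / (2 * W^2)))"
      using W P unfolding P_def by (simp add: divide_simps)
    then show ?thesis using ln_1_plus_ge_nonneg[of "b * (N / (2 * W^2))"] b N W by simp
  qed
  moreover have "b^2 / B \<le> ln (1 + b^2 / V) / 2"
    unfolding B_def by (rule half_ln_1_plus_ge[OF V])
  ultimately show ?thesis unfolding D_def N_def by linarith
qed

lemma ln_1_minus_ge:
  fixes b N W :: real
  assumes W: "0 < W" and N: "0 \<le> b * N" "b * N \<le> W^2"
  defines "Q \<equiv> 2 * W^2 - b * N"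
  shows "Q / (4 * W^2) - W^2 / Q \<le> ln (1 - b * (N / (2 * W^2)))"
proof -
  have Q: "0 < Q" using N W by (simp add: Q_def) (smt (verit) zero_less_power)
  define r where "r = 1 - b * (N / (2 * W^2))"
  have r: "r = Q / (2 * W^2)" using W by (simp add: r_def Q_def field_simps)
  have "0 < r" using Q W by (simp add: r)
  moreover have "r \<le> 1" using N W by (simp add: r_def)
  ultimately have "r / 2 - 1 / (2 * r) \<le> ln r" by (rule ln_ge_le_1)
  moreover have "r / 2 - 1 / (2 * r) = Q / (4 * W^2) - W^2 / Q" by (simp add: r)
  ultimately show ?thesis by (simp add: r_def)
qed

text \<open>With \<open>h\<close> in place of \<open>b\<close>, the product is
  \<open>(W - V) * (W + V)\<close>. Hence the linear factor
  \<open>1 - b * (x * (V + W) / (2 * W^2))\<close> is at least 1/2 and its logarithm is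
  controlled.\<close>

lemma gradient_bound:
  fixes V b x h :: real
  assumes V: "0 < V" and b: "0 \<le> b" "b \<le> h" and x: "0 \<le> x"
  defines "W \<equiv> V + h * x"
  shows "0 \<le> b * (x * (V + W))" "b * (x * (V + W)) \<le> W^2"
proof -
  have W: "0 < W" using V b x by (simp add: W_def add_pos_nonneg)
  show "0 \<le> b * (x * (V + W))" using V b x W by simp
  have "b * (x * (V + W)) \<le> h * (x * (V + W))"
    using V b x W by (intro mult_right_mono) auto
  also have "\<dots> = W^2 - V^2" by (simp add: W_def algebra_simps power2_eq_square)
  also have "\<dots> \<le> W^2" by simp
  finally show "b * (x * (V + W)) \<le> W^2" .
qed

text \<open>Here g points against G without carrying it past the origin. After the logarithms are
  bounded and \<open>D\<close> is replaced by the larger \<open>W\<close>, the terms of first order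
  in \<open>b\<close> cancel, leaving \<open>b^2\<close> times a nonnegative quantity.\<close>

lemma scalar_step_neg_far:
  fixes V b x h :: real
  assumes V: "0 < V" and b: "0 \<le> b" "b \<le> h" and x: "b \<le> x"
  defines "W \<equiv> V + h * x"
  shows "(x - b)^2 / (2 * (V + b^2 + h * (x - b))) \<le>
    x^2 / (2 * W) + ln (1 - b * (x * (V + W) / (2 * W^2))) + ln (1 + b^2 / V) / 2"
proof -
  define M where "M = V + W"
  define D where "D = V + b^2 + h * (x - b)"
  define Q where "Q = 2 * W^2 - b * (x * M)"
  define B where "B = 2 * V + b^2"
  \<comment> \<open>\<open>b * K\<close> is the numerator of
    \<open>x^2 / (2 * W) - (x - b)^2 / (2 * D)\<close> over \<open>2 * W * D\<close>.\<close>
  define K where "K = x * M - b * W + b * x^2"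
  have x0: "0 \<le> x" using b x by simp
  have W: "0 < W" using V b x0 by (simp add: W_def add_pos_nonneg)
  have D: "0 < D" and B: "0 < B" using V b x by (simp_all add: D_def B_def add_pos_nonneg)
  have DW: "D \<le> W"
  proof -
    have "b * b \<le> h * b" using b by (intro mult_right_mono) auto
    then show ?thesis by (simp add: D_def W_def power2_eq_square algebra_simps)
  qed
  note gb = gradient_bound[OF V b x0, folded W_def, folded M_def]
  have Q: "0 < Q" using gb W by (simp add: Q_def) (smt (verit) zero_less_power)
  have "0 \<le> K"
  proof -
    have "b * W \<le> x * M" using b x V W unfolding M_def by (intro mult_mono) auto
    then show ?thesis using b by (simp add: K_def)
  qed
  have "0 \<le> x^2 * (2 * Q - M^2) / (4 * W^2 * Q) + (2 * W - B) / (2 * W * B)"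
  proof (intro add_nonneg_nonneg divide_nonneg_nonneg mult_nonneg_nonneg)
    have "2 * Q - M^2 = 2 * (M * (x * (h - b))) + (h * x)^2"
      by (simp add: Q_def M_def W_def algebra_simps power2_eq_square)
    then show "0 \<le> 2 * Q - M^2"
      using b x0 V W unfolding M_def by (simp add: add_nonneg_nonneg mult_nonneg_nonneg)
    have "b * b \<le> h * x" using b x by (intro mult_mono) auto
    moreover have "0 \<le> h * x" using b x0 by simp
    ultimately show "0 \<le> 2 * W - B" by (simp add: W_def B_def power2_eq_square)
  qed (use W Q B in auto)
  then have "0 \<le> b^2 * (x^2 * (2 * Q - M^2) / (4 * W^2 * Q) + (2 * W - B) / (2 * W * B))"
    by simp
  also have "\<dots> = b * K / (2 * W^2) + (Q / (4 * W^2) - W^2 / Q) + b^2 / B"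
    using W Q B by (simp add: K_def divide_simps) (simp add: Q_def algebra_simps power2_eq_square)
  also have "\<dots> \<le> b * K / (2 * W * D) + (Q / (4 * W^2) - W^2 / Q) + b^2 / B"
    using DW W D b \<open>0 \<le> K\<close>
    by (intro add_right_mono divide_left_mono) (auto simp: power2_eq_square)
  also have "b * K / (2 * W * D) = x^2 / (2 * W) - (x - b)^2 / (2 * D)"
    using W D by (simp add: divide_simps)
      (simp add: K_def M_def W_def D_def algebra_simps power2_eq_square)
  finally have "(x - b)^2 / (2 * D) \<le> x^2 / (2 * W) + (Q / (4 * W^2) - W^2 / Q) + b^2 / B"
    by simp
  with ln_1_minus_ge[OF W gb] half_ln_1_plus_ge[OF V, of b]
  show ?thesis unfolding Q_def B_def D_def M_def by linarith
qed

text \<open>The overshooting case: g carries G past the origin, so the new length is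
  \<open>b - x\<close>. Writing \<open>b = x + y\<close> makes \<open>x \<le> b\<close> a sign
  condition.\<close>

lemma scalar_step_neg_near_tight:
  fixes V b x :: real
  assumes V: "0 < V" and x: "0 \<le> x" "x \<le> b"
  defines "W \<equiv> V + b * x"
  shows "(b - x)^2 / (2 * (V + b^2 + b * (b - x))) \<le>
    x^2 / (2 * W) + ln (1 - b * (x * (V + W) / (2 * W^2))) + ln (1 + b^2 / V) / 2"
proof -
  define y where "y = b - x"
  have y: "b = x + y" "0 \<le> y" "0 \<le> b" using x by (simp_all add: y_def)
  define D where "D = V + b^2 + b * y"
  define Q where "Q = V^2 + W^2"
  define B where "B = 2 * V + b^2"
  have W: "0 < W" using V y x by (simp add: W_def add_pos_nonneg)
  have D: "0 < D" and B: "0 < B" using V y by (simp_all add: D_def B_def add_pos_nonneg)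
  have Q: "0 < Q" using V by (simp add: Q_def add_pos_nonneg)
  \<comment> \<open>Since the hint is \<open>b\<close>, \<open>b * x = W - V\<close> and the product
    is \<open>W^2 - V^2\<close>.\<close>
  have Q_eq: "2 * W^2 - b * (x * (V + W)) = Q"
    by (simp add: Q_def W_def algebra_simps power2_eq_square)
  \<comment> \<open>Expanded in \<open>V, x, y\<close>, this polynomial has only nonnegative coefficients.\<close>
  have "0 \<le> 2 * x^2 * W * Q * B * (2 * D) + Q * Q * B * (2 * D) - 4 * W^2 * W^2 * B * (2 * D)
      + 4 * W^2 * Q * b^2 * (2 * D) - 4 * W^2 * Q * B * y^2"
    using V x(1) y(2) unfolding Q_def B_def D_def W_def y(1)
    apply (simp add: algebra_simps power2_eq_square)
    apply (intro add_nonneg_nonneg mult_nonneg_nonneg; simp)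
    done
  then have "0 \<le> (2 * x^2 * W * Q * B * (2 * D) + Q * Q * B * (2 * D) - 4 * W^2 * W^2 * B * (2 * D)
      + 4 * W^2 * Q * b^2 * (2 * D) - 4 * W^2 * Q * B * y^2) / (4 * W^2 * Q * B * (2 * D))"
    using W Q B D by simp
  also have "\<dots> = x^2 / (2 * W) + (Q / (4 * W^2) - W^2 / Q) + b^2 / B - y^2 / (2 * D)"
    using W Q B D by (simp add: add_divide_distrib diff_divide_distrib power2_eq_square)
  finally have "y^2 / (2 * D) \<le> x^2 / (2 * W) + (Q / (4 * W^2) - W^2 / Q) + b^2 / B" by simp
  with ln_1_minus_ge[OF W gradient_bound[OF V y(3) order_refl x(1), folded W_def]]
    half_ln_1_plus_ge[OF V, of b]
  show ?thesis unfolding Q_eq unfolding B_def D_def y_def by linarith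
qed

text \<open>The map \<open>- ln (1 - p)\<close> has slope at least 1 on [0, 1).\<close>

lemma ln_1_minus_mono:
  fixes p q :: real
  assumes "0 \<le> p" "p \<le> q" "q < 1"
  shows "q - p \<le> ln (1 - p) - ln (1 - q)"
proof -
  have "q - p \<le> (q - p) / (1 - p)"
    using assms by (simp add: le_divide_eq mult_left_le)
  also have "\<dots> = 1 - (1 - q) / (1 - p)" using assms by (simp add: field_simps)
  also have "\<dots> \<le> - ln ((1 - q) / (1 - p))"
    using ln_le_minus_one[of "(1 - q) / (1 - p)"] assms by simp
  also have "\<dots> = ln (1 - p) - ln (1 - q)" using assms by (simp add: ln_div)
  finally show ?thesis .
qed

text \<open>For \<open>x \<le> b\<close> the inequality is tightest at \<open>h = b\<close>, the case settled above.\<close>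

lemma scalar_step_neg_near:
  fixes V b x h :: real
  assumes V: "0 < V" and x: "0 \<le> x" "x \<le> b" and h: "b \<le> h"
  defines "W \<equiv> V + h * x"
  shows "(b - x)^2 / (2 * (V + b^2 + h * (b - x))) \<le>
    x^2 / (2 * W) + ln (1 - b * (x * (V + W) / (2 * W^2))) + ln (1 + b^2 / V) / 2"
proof -
  define U where "U = V + b * x"
  define q where "q = (\<lambda>W. b * (x * (V + W) / (2 * W^2)))"
  have b: "0 \<le> b" using x by simp
  have U: "0 < U" using V b x by (simp add: U_def add_pos_nonneg)
  have UW: "U \<le> W" using h x by (simp add: U_def W_def mult_right_mono)
  have W: "0 < W" using U UW by simp
  have inv: "1 / W \<le> 1 / U" "1 / W^2 \<le> 1 / U^2"
    using U UW by (auto intro!: divide_left_mono power_mono)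
  have q_eq: "q w = b * x / 2 * (1 / w) + b * x * V / 2 * (1 / w^2)" if "0 < w" for w
    using that by (simp add: q_def field_simps power2_eq_square)
  \<comment> \<open>Lowering the hint from \<open>h\<close> to \<open>b\<close> raises
    \<open>x^2 / (2 * W)\<close>, but because \<open>x \<le> b\<close> by no more than it raises
    \<open>q\<close>; by \<open>ln_1_minus_mono\<close> the logarithm falls at least as much, so the
    right-hand side does not grow.\<close>
  have diff: "x^2 / (2 * U) - x^2 / (2 * W) \<le> q U - q W"
  proof -
    have "x^2 / (2 * U) - x^2 / (2 * W) = x * x / 2 * (1 / U - 1 / W)"
      by (simp add: algebra_simps power2_eq_square)
    also have "\<dots> \<le> b * x / 2 * (1 / U - 1 / W)"
      using x inv by (intro mult_right_mono) (auto intro: mult_right_mono)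
    also have "\<dots> \<le> b * x / 2 * (1 / U - 1 / W) + b * x * V / 2 * (1 / U^2 - 1 / W^2)"
      using x b V inv by simp
    also have "\<dots> = q U - q W"
      unfolding q_eq[OF U] q_eq[OF W] right_diff_distrib by linarith
    finally show ?thesis .
  qed
  have "0 \<le> q W" using b x V W by (simp add: q_def)
  moreover have "q W \<le> q U"
    unfolding q_eq[OF U] q_eq[OF W] using inv b x V by (intro add_mono mult_left_mono) auto
  moreover have "q U < 1"
  proof -
    have "b * (x * (V + U)) \<le> U^2"
      using gradient_bound(2)[OF V b order_refl x(1)] by (simp add: U_def)
    also have "U^2 < 2 * U^2" using U by simp
    finally show ?thesis using U by (simp add: q_def)
  qed
  ultimately have lnq: "q U - q W \<le> ln (1 - q W) - ln (1 - q U)" by (rule ln_1_minus_mono)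
  have "0 < V + b^2 + h * (b - x)" "0 < V + b^2 + b * (b - x)"
    using V x b h by (auto intro!: add_pos_nonneg mult_nonneg_nonneg)
  then have "(b - x)^2 / (2 * (V + b^2 + h * (b - x))) \<le> (b - x)^2 / (2 * (V + b^2 + b * (b - x)))"
    using x h by (intro divide_left_mono mult_pos_pos mult_left_mono add_left_mono mult_right_mono)
      auto
  also have "\<dots> \<le> x^2 / (2 * U) + ln (1 - q U) + ln (1 + b^2 / V) / 2"
    unfolding q_def U_def by (rule scalar_step_neg_near_tight[OF V x])
  also have "\<dots> \<le> x^2 / (2 * W) + ln (1 - q W) + ln (1 + b^2 / V) / 2"
    using diff lnq by linarith
  finally show ?thesis by (simp add: q_def)
qed

lemma scalar_step:
  fixes V c x h :: real
  assumes V: "0 < V" and c: "\<bar>c\<bar> \<le> h" and x: "0 \<le> x"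
  defines "W \<equiv> V + h * x"
  shows "(x + c)^2 / (2 * (V + c^2 + h * \<bar>x + c\<bar>)) \<le>
    x^2 / (2 * W) + ln (1 + c * (x * (V + W) / (2 * W^2))) + ln (1 + c^2 / V) / 2"
proof -
  \<comment> \<open>The component along G lengthens G, shortens it up to the origin, or carries it
    to the other side.\<close>
  consider "0 \<le> c" | "c \<le> 0" "- c \<le> x" | "c \<le> 0" "x \<le> - c" by linarith
  then show ?thesis
  proof cases
    case 1
    then show ?thesis using scalar_step_pos[OF V, of c h x] c x by (simp add: W_def)
  next
    case 2
    then show ?thesis using scalar_step_neg_far[OF V, of "- c" h x] c x by (simp add: W_def)
  next
    case 3
    have eqs: "(x + c)^2 = (- c - x)^2" "\<bar>x + c\<bar> = - c - x"
      using 3 by (simp_all add: power2_eq_square algebra_simps)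
    show ?thesis
      using scalar_step_neg_near[OF V x, of "- c" h] 3 c unfolding eqs W_def by simp
  qed
qed

subsection \<open>The potential\<close>

text \<open>The constant factor \<open>(h 1)^2\<close> is kept outside. The hint is a separate
  argument because it may change between rounds while \<open>V\<close> and \<open>x\<close> stay
  fixed.\<close>

definition potential :: "real \<Rightarrow> real \<Rightarrow> real \<Rightarrow> real" where
  "potential V h x = exp (x^2 / (2 * V + 2 * h * x)) / sqrt V"

lemma potential_antimono_hint:
  assumes "0 < V" "0 \<le> x" "0 \<le> h" "h \<le> h'"
  shows "potential V h' x \<le> potential V h x"
proof -
  have "x^2 / (2 * V + 2 * h' * x) \<le> x^2 / (2 * V + 2 * h * x)"
    using assms by (intro divide_left_mono mult_pos_pos add_left_mono mult_right_mono)
      (auto intro: add_pos_nonneg)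
  then show ?thesis using assms by (simp add: potential_def divide_right_mono)
qed

text \<open>Here \<open>d\<close> is the squared length of the component orthogonal to \<open>G\<close>: the gain in
  \<open>ln V\<close> outweighs the growth of the exponent.\<close>

lemma exponent_orthogonal_bound:
  fixes A d h k m :: real
  assumes A: "0 < A" and d: "0 \<le> d" and k: "0 \<le> k" "0 \<le> h" and m: "k \<le> m" "m^2 = k^2 + d"
  shows "m^2 / (2 * (A + d + h * m)) - ln (A + d) / 2 \<le> k^2 / (2 * (A + h * k)) - ln A / 2"
proof -
  have pos: "0 < A + h * k" "0 < A + d + h * k" "0 < A + d + h * m"
    using A d k m(1) by (auto intro!: add_pos_nonneg mult_nonneg_nonneg)
  have "m^2 / (2 * (A + d + h * m)) \<le> (k^2 + d) / (2 * (A + d + h * k))"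
    unfolding m(2) using pos k m d
    by (intro divide_left_mono mult_pos_pos mult_left_mono add_left_mono)
      auto
  also have "\<dots> = (k^2 / (A + d + h * k) + d / (A + d + h * k)) / 2"
    by (simp only: add_divide_distrib divide_divide_eq_left mult.commute)
  also have "\<dots> \<le> (k^2 / (A + h * k) + d / (A + d)) / 2"
  proof -
    have "k^2 / (A + d + h * k) \<le> k^2 / (A + h * k)"
      using pos d by (intro divide_left_mono mult_pos_pos) auto
    moreover have "d / (A + d + h * k) \<le> d / (A + d)"
      using pos A d k by (intro divide_left_mono mult_pos_pos) auto
    ultimately show ?thesis by (intro divide_right_mono add_mono) auto
  qed
  also have "d / (A + d) \<le> ln (A + d) - ln A"
  proof -
    have "ln (A / (A + d)) \<le> A / (A + d) - 1" using A d by (intro ln_le_minus_one) auto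
    also have "\<dots> = - (d / (A + d))" using A d by (simp add: field_simps)
    finally show ?thesis using A d by (simp add: ln_div)
  qed
  finally have "m^2 / (2 * (A + d + h * m)) \<le> k^2 / (A + h * k) / 2 + (ln (A + d) - ln A) / 2"
    by (simp add: add_divide_distrib)
  also have "k^2 / (A + h * k) / 2 = k^2 / (2 * (A + h * k))" by simp
  finally show ?thesis unfolding diff_divide_distrib by (simp only: diff_le_eq le_diff_eq add_diff_eq ac_simps)
qed

text \<open>Split g into its component \<open>c\<close> along G and an orthogonal part of squared
  length \<open>d\<close>. After taking logarithms, \<open>exponent_orthogonal_bound\<close> removes
  \<open>d\<close> and \<open>scalar_step\<close> handles \<open>c\<close>.\<close>

lemma potential_step:
  fixes G g :: "'a::real_inner"
  assumes V: "0 < V" and g: "norm g \<le> h"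
  defines "x \<equiv> norm G"
  shows "potential (V + (norm g)^2) h (norm (G + g)) \<le>
    potential V h x * (1 + (G \<bullet> g) * ((2 * V + h * x) / (2 * (V + h * x)^2)))"
proof -
  \<comment> \<open>For G = 0, division by zero gives \<open>c = 0\<close>: all of g counts as
    orthogonal, and \<open>x * c = G \<bullet> g\<close> still holds.\<close>
  define c where "c = (G \<bullet> g) / x"
  define W where "W = V + h * x"
  define d where "d = (norm g)^2 - c^2"
  define m where "m = norm (G + g)"
  define p where "p = x * (V + W) / (2 * W^2)"
  have h: "0 \<le> h" using g norm_ge_zero[of g] by linarith
  have x: "0 \<le> x" by (simp add: x_def)
  have W: "0 < W" using V h x by (simp add: W_def add_pos_nonneg)
  have xc: "x * c = G \<bullet> g" by (simp add: c_def x_def)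
  have c_le: "\<bar>c\<bar> \<le> norm g"
  proof (cases "x = 0")
    case False
    then have "\<bar>G \<bullet> g\<bar> / x \<le> x * norm g / x"
      by (intro divide_right_mono) (auto simp: x_def Cauchy_Schwarz_ineq2)
    then show ?thesis using False by (simp add: c_def x_def)
  qed (simp add: c_def)
  then have c: "\<bar>c\<bar> \<le> h" using g by simp
  have d: "0 \<le> d" using power_mono[OF c_le, of 2] by (simp add: d_def)
  have m2: "m^2 = \<bar>x + c\<bar>^2 + d"
  proof -
    have "m^2 = x^2 + 2 * (G \<bullet> g) + (norm g)^2"
      unfolding m_def x_def power2_norm_eq_inner
      by (simp add: inner_add_left inner_add_right inner_commute[of g G])
    then show ?thesis using xc by (simp add: d_def power2_eq_square algebra_simps)
  qed
  have m: "\<bar>x + c\<bar> \<le> m"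
    using m2 d by (intro power2_le_imp_le[of "\<bar>x + c\<bar>" m]) (auto simp: m_def)
  have Vc: "0 < V + c^2" using V by (simp add: add_pos_nonneg)
  have Vd: "V + (norm g)^2 = V + c^2 + d" by (simp add: d_def)
  have z: "0 < 1 + c * p"
  proof -
    have "0 \<le> p" using x V W by (simp add: p_def)
    then have "- c * p \<le> \<bar>c\<bar> * p" by (intro mult_right_mono) auto
    also have "\<bar>c\<bar> * p = \<bar>c\<bar> * (x * (V + W)) / (2 * W^2)" by (simp add: p_def)
    also have "\<dots> \<le> W^2 / (2 * W^2)"
      using gradient_bound(2)[OF V abs_ge_zero c x] by (intro divide_right_mono) (auto simp: W_def)
    also have "\<dots> = 1 / 2" using W by simp
    finally show ?thesis by simp
  qed
  have "ln (potential (V + (norm g)^2) h m)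
      = m^2 / (2 * (V + c^2 + d + h * m)) - ln (V + c^2 + d) / 2"
    using Vc d unfolding potential_def Vd by (simp add: ln_div ln_sqrt algebra_simps)
  also have "\<dots> \<le> (x + c)^2 / (2 * (V + c^2 + h * \<bar>x + c\<bar>)) - ln (V + c^2) / 2"
    using exponent_orthogonal_bound[OF Vc d abs_ge_zero h m m2] by simp
  also have "\<dots> \<le> x^2 / (2 * W) + ln (1 + c * p) + ln (1 + c^2 / V) / 2 - ln (V + c^2) / 2"
    using scalar_step[OF V c x] by (simp add: W_def p_def)
  also have "ln (1 + c^2 / V) = ln (V + c^2) - ln V"
  proof -
    have "1 + c^2 / V = (V + c^2) / V" using V by (simp add: field_simps)
    then show ?thesis using V Vc by (simp add: ln_div)
  qed
  also have "x^2 / (2 * W) + ln (1 + c * p) + (ln (V + c^2) - ln V) / 2 - ln (V + c^2) / 2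
      = ln (potential V h x * (1 + c * p))"
  proof -
    have "0 < potential V h x" using V by (simp add: potential_def)
    then have "ln (potential V h x * (1 + c * p)) = ln (potential V h x) + ln (1 + c * p)"
      using z by (simp add: ln_mult)
    also have "ln (potential V h x) = x^2 / (2 * W) - ln V / 2"
      using V by (simp add: potential_def ln_div ln_sqrt W_def algebra_simps)
    finally show ?thesis by (simp add: field_simps)
  qed
  finally have "potential (V + (norm g)^2) h m \<le> potential V h x * (1 + c * p)"
    using V Vc d z by (subst (asm) ln_le_cancel_iff) (auto simp: potential_def Vd)
  also have "c * p = (G \<bullet> g) * ((2 * V + h * x) / (2 * (V + h * x)^2))"
    unfolding p_def W_def xc[symmetric] by (simp add: algebra_simps)
  finally show ?thesis by (simp add: m_def)
qed

subsection \<open>The conjugate of the potential\<close>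

text \<open>If \<open>y\<close> exceeds \<open>L\<close>, subadditivity of the root leaves
  \<open>s = sqrt (y - L)\<close>, and \<open>s \<le> 1 + s^2 \<le> exp (s^2)\<close>.\<close>

lemma sqrt_diff_le_exp:
  fixes L y :: real
  assumes "0 \<le> L" "0 \<le> y"
  shows "sqrt y - sqrt L \<le> exp (y - L)"
proof (cases "y \<le> L")
  case True
  then have "sqrt y - sqrt L \<le> 0" by simp
  also have "0 \<le> exp (y - L)" by simp
  finally show ?thesis .
next
  case False
  define s where "s = sqrt (y - L)"
  have s: "s^2 = y - L" using False by (simp add: s_def)
  have "sqrt y \<le> s + sqrt L"
    using sqrt_add_le_add_sqrt[of "y - L" L] False assms by (simp add: s_def)
  moreover have "s \<le> 1 + s^2"
  proof -
    have "0 \<le> s" using False by (simp add: s_def)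
    moreover have "2 * s \<le> 1 + s^2"
      using zero_le_power2[of "s - 1"] by (simp add: power2_eq_square algebra_simps)
    ultimately show ?thesis by linarith
  qed
  moreover have "1 + s^2 \<le> exp (y - L)" using exp_ge_add_one_self[of "y - L"] s by simp
  ultimately show ?thesis by simp
qed

lemma potential_conjugate:
  fixes V a h u x :: real
  assumes V: "0 < V" and a: "0 < a" and h: "0 < h" and u: "0 \<le> u" and x: "0 \<le> x"
  shows "u * x - a^2 * potential V h x \<le>
    max (2 * u * sqrt (V * ln_plus (2 * u * V / a^2)))
        (4 * h * u * ln (4 * h * u * sqrt V / a^2))"
proof -
  define R where "R = sqrt V"
  have R: "0 < R" "V = R^2" using V by (simp_all add: R_def)
  have nonneg: "0 < potential V h x" using V by (simp add: potential_def)
  consider "u = 0" | "0 < u" "h * x \<le> V" | "0 < u" "V < h * x" using u by linarith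
  then show ?thesis
  proof cases
    case 1
    then show ?thesis using nonneg a by simp
  next
    case 2
    \<comment> \<open>The exponent is at least \<open>y\<close>, and
      \<open>x = 2 * R * sqrt y\<close>. The choice of \<open>k\<close> gives
      \<open>2 * u * R = a^2 / R * k\<close>, so both terms are compared at the common scale
      \<open>2 * u * R\<close>, where \<open>sqrt_diff_le_exp\<close> applies.\<close>
    define k where "k = 2 * u * V / a^2"
    define L where "L = ln_plus k"
    define y where "y = x^2 / (4 * V)"
    have k: "0 < k" using 2 V a by (simp add: k_def)
    have L: "0 \<le> L" "k \<le> exp L"
    proof -
      show "0 \<le> L" by (simp add: L_def ln_plus_def)
      have "ln k \<le> L" by (simp add: L_def ln_plus_def)
      then show "k \<le> exp L" using k by (metis exp_le_cancel_iff exp_ln)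
    qed
    have y: "0 \<le> y" "x = 2 * R * sqrt y"
      using V x by (simp_all add: y_def R_def real_sqrt_divide real_sqrt_mult)
    have "y \<le> x^2 / (2 * V + 2 * h * x)"
      unfolding y_def using 2 V h x
      by (intro divide_left_mono mult_pos_pos) (auto intro: add_pos_nonneg)
    then have "exp y / R \<le> potential V h x"
      using R by (simp add: potential_def R_def[symmetric] divide_right_mono)
    moreover have "2 * u * R * exp (y - L) \<le> a^2 * (exp y / R)"
    proof -
      have "2 * u * R * exp (y - L) = a^2 / R * (exp (y - L) * k)"
        using a R(1) unfolding k_def R(2) by (simp add: power2_eq_square)
      also have "\<dots> \<le> a^2 / R * (exp (y - L) * exp L)"
        using L(2) R(1) by (intro mult_left_mono) auto
      also have "\<dots> = a^2 * (exp y / R)" by (simp add: exp_diff)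
      finally show ?thesis .
    qed
    ultimately have "2 * u * R * exp (y - L) \<le> a^2 * potential V h x"
      using a by (smt (verit) mult_left_mono zero_le_power2)
    moreover have "2 * u * R * (sqrt y - sqrt L) \<le> 2 * u * R * exp (y - L)"
      using sqrt_diff_le_exp[OF L(1) y(1)] 2 R by (intro mult_left_mono) auto
    moreover have "2 * u * R * (sqrt y - sqrt L) = u * x - 2 * u * sqrt (V * L)"
      by (simp add: y(2) R_def real_sqrt_mult algebra_simps)
    ultimately have "u * x - a^2 * potential V h x \<le> 2 * u * sqrt (V * L)" by linarith
    then show ?thesis by (simp add: L_def k_def)
  next
    case 3
    \<comment> \<open>Now the exponent is at least the linear \<open>y\<close>. This
      \<open>k\<close> turns \<open>a^2 * (exp y / R)\<close> into
      \<open>4 * h * u * exp (y - ln k)\<close>, whose tangent bound at exponent 0 has slope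
      matching \<open>u * x\<close>.\<close>
    define k where "k = 4 * h * u * R / a^2"
    define y where "y = x / (4 * h)"
    have k: "0 < k" using 3 h R a by (simp add: k_def)
    have x0: "0 < x" using 3 V x h by (cases "x = 0") auto
    have "y = x^2 / (4 * h * x)" using x0 h by (simp add: y_def power2_eq_square)
    also have "\<dots> \<le> x^2 / (2 * V + 2 * h * x)"
      using 3 V h x0 by (intro divide_left_mono mult_pos_pos) (auto intro: add_pos_nonneg)
    finally have "exp y / R \<le> potential V h x"
      using R by (simp add: potential_def R_def[symmetric] divide_right_mono)
    then have "a^2 * (exp y / R) \<le> a^2 * potential V h x"
      by (rule mult_left_mono) simp
    moreover have "a^2 * (exp y / R) = 4 * h * u * exp (y - ln k)"
      using k a h 3 R by (simp add: exp_diff) (simp add: k_def)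
    moreover have "4 * h * u * (1 + (y - ln k)) \<le> 4 * h * u * exp (y - ln k)"
      using exp_ge_add_one_self[of "y - ln k"] h 3 by (intro mult_left_mono) auto
    moreover have "4 * h * u * (1 + (y - ln k)) = 4 * h * u + u * x - 4 * h * u * ln k"
      using h by (simp add: y_def field_simps)
    moreover have "0 \<le> 4 * h * u" using h u by simp
    ultimately have "u * x - a^2 * potential V h x \<le> 4 * h * u * ln k" by linarith
    then show ?thesis by (simp add: k_def R_def)
  qed
qed

subsection \<open>Regret of FreeGrad\<close>

lemma grad_var_pos: "0 < h 1 \<Longrightarrow> 0 < grad_var h g t"
  by (simp add: grad_var_def add_pos_nonneg sum_nonneg)

text \<open>Exposes the coefficient of \<open>potential_step\<close>, so that the loss of a round is
  the negated linear term there, times \<open>(h 1)^2\<close>.\<close>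

lemma freegrad_eq:
  assumes "V = grad_var h g (t - 1)" and "G = grad_sum g (t - 1)"
  shows "freegrad h g t = - ((h 1)^2 * potential V (h t) (norm G) *
    ((2 * V + h t * norm G) / (2 * (V + h t * norm G)^2))) *\<^sub>R G"
  unfolding freegrad_def Let_def assms[symmetric] potential_def
  by (simp add: ac_simps)

text \<open>Each round has two stages: raising the hint can only lower the potential, then
  \<open>potential_step\<close> applies with the new hint fixed. The initial value is
  \<open>(h 1)^2 / sqrt ((h 1)^2) = h 1\<close>.\<close>

lemma freegrad_loss_bound:
  assumes h1: "0 < h 1" and mono: "mono_on {1..} h"
    and hint: "\<And>t. t \<ge> 1 \<Longrightarrow> norm (g t) \<le> h t"
  shows "(\<Sum>t = 1..n. g t \<bullet> freegrad h g t) \<le>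
    h 1 - (h 1)^2 * potential (grad_var h g n) (h n) (norm (grad_sum g n))"
proof (induction n)
  case 0
  then show ?case using h1
    by (simp add: grad_var_def grad_sum_def potential_def power2_eq_square)
next
  case (Suc n)
  define V where "V = grad_var h g n"
  define G where "G = grad_sum g n"
  define H where "H = h (Suc n)"
  define \<gamma> where "\<gamma> = g (Suc n)"
  have V: "0 < V" unfolding V_def by (rule grad_var_pos) (fact h1)
  have V': "grad_var h g (Suc n) = V + (norm \<gamma>)^2"
    and G': "grad_sum g (Suc n) = G + \<gamma>"
    by (simp_all add: V_def G_def \<gamma>_def grad_var_def grad_sum_def)
  have antimono: "potential V H (norm G) \<le> potential V (h n) (norm G)"
  \<comment> \<open>\<open>h 0\<close> is outside the range of monotonicity, but G = 0 makes the
    initial potential independent of the hint.\<close>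
  proof (cases "n = 0")
    case True
    then show ?thesis by (simp add: G_def grad_sum_def potential_def)
  next
    case False
    then have "h n \<le> H" "0 \<le> h n"
      using mono_onD[OF mono, of n "Suc n"] mono_onD[OF mono, of 1 n] h1 by (auto simp: H_def)
    then show ?thesis using V by (intro potential_antimono_hint) auto
  qed
  have "\<gamma> \<bullet> freegrad h g (Suc n) = (h 1)^2 * (potential V H (norm G)
      - potential V H (norm G) * (1 + (G \<bullet> \<gamma>) *
          ((2 * V + H * norm G) / (2 * (V + H * norm G)^2))))"
    by (subst freegrad_eq[of V h g _ G])
      (simp_all add: V_def G_def H_def inner_commute algebra_simps)
  also have "\<dots> \<le> (h 1)^2 * (potential V (h n) (norm G)
      - potential (V + (norm \<gamma>)^2) H (norm (G + \<gamma>)))"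
    using antimono potential_step[OF V, of \<gamma> H G] hint[of "Suc n"]
    by (intro mult_left_mono diff_mono) (auto simp: H_def \<gamma>_def)
  finally show ?case
    using Suc.IH unfolding V' G' by (simp add: V_def G_def H_def \<gamma>_def algebra_simps)
qed

theorem theorem6:
  fixes g :: "nat \<Rightarrow> real ^ 'd"
    and H :: "(nat \<Rightarrow> real ^ 'd) \<Rightarrow> nat \<Rightarrow> real"
    and h :: "nat \<Rightarrow> real"
    and w :: "real ^ 'd"
    and T :: nat
  assumes "norm (g 1) > 0"
    and "h = H g"
    and "mono_on {1..} h"
    and "\<And>t. t \<ge> 1 \<Longrightarrow> h t \<ge> Max ((\<lambda>s. norm (g s)) ` {1..t})"
    and "scale_equivariant_at H g"
    and "T \<ge> 1"
  shows "(\<Sum>t = 1..T. g t \<bullet> (freegrad h g t - w)) \<le>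
    max (2 * norm w * sqrt (grad_var h g T * ln_plus (2 * norm w * grad_var h g T / (h 1)\<^sup>2)))
        (4 * h T * norm w * ln (4 * h T * norm w * sqrt (grad_var h g T) / (h 1)\<^sup>2))
      + h 1"
proof -
  have hint: "norm (g t) \<le> h t" if "t \<ge> 1" for t
    using assms(4)[OF that] that by (auto intro: order_trans[OF Max_ge])
  have h1: "0 < h 1" using hint[of 1] assms(1) by linarith
  have hT: "0 < h T" using mono_onD[OF assms(3), of 1 T] assms(6) h1 by simp
  define G where "G = grad_sum g T"
  define V where "V = grad_var h g T"
  have V: "0 < V" unfolding V_def by (rule grad_var_pos) (fact h1)
  have "(\<Sum>t = 1..T. g t \<bullet> (freegrad h g t - w)) = (\<Sum>t = 1..T. g t \<bullet> freegrad h g t) - G \<bullet> w"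
    by (simp add: G_def grad_sum_def inner_diff_right sum_subtractf inner_sum_left)
  \<comment> \<open>Cauchy-Schwarz leaves only the length of G, so the scalar conjugate bound
    applies with slope \<open>norm w\<close>.\<close>
  also have "\<dots> \<le> h 1 - (h 1)^2 * potential V (h T) (norm G) + norm w * norm G"
    using freegrad_loss_bound[where h = h and g = g and n = T, OF h1 assms(3) hint] Cauchy_Schwarz_ineq2[of G w]
    by (simp add: G_def V_def mult.commute)
  also have "\<dots> \<le> max (2 * norm w * sqrt (V * ln_plus (2 * norm w * V / (h 1)\<^sup>2)))
      (4 * h T * norm w * ln (4 * h T * norm w * sqrt V / (h 1)\<^sup>2)) + h 1"
    using potential_conjugate[OF V h1 hT, of "norm w" "norm G"] by simp
  finally show ?thesis unfolding V_def .
qed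

end
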